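(* Let $\Gamma$ be a finite, simple, connected cubic graph and let $G\leq\mathrm{Aut}(\Gamma)$ be vertex-transitive such that $(\Gamma,G)$ is locally-$\mathbb Z_2^{[3]}$ and not degenerate. Let $\mathrm M(\Gamma,G)$ and $\mathcal C(\Gamma,G)$ be as defined below. Then $\mathrm M(\Gamma,G)$ is a connected tetravalent $G$-arc-transitive graph (in particular $G$ acts faithfully on its vertex-set) whose order is half the order of $\Gamma$. Moreover, $\mathcal C(\Gamma,G)$ is a cycle decomposition of $\mathrm M(\Gamma,G)$ preserved by $G$, so it is a $G$-arc-transitive cycle decomposition of $\mathrm M(\Gamma,G)$.
   Context: $(\Gamma,G)$ is locally-$\mathbb Z_2^{[3]}$ if for a vertex $v$ the group induced by $G_v$ on the neighbourhood $\Gamma(v)$ is permutation isomorphic to the group of order $2$ acting on $3$ points. Then each vertex $u$ has a unique neighbour $u'$ fixed by $G_u$; $\mathcal T=\{\{u,u'\}:u\in\mathrm V(\Gamma)\}$ is a $G$-edge-orbit forming a perfect matching, and the remaining edges form a second $G$-edge-orbit $\mathcal R$, which induces a spanning subgraph that is a disjoint union of cycles $C_1,\dots,C_n$. The pair is degenerate if for some $\{u,u'\},\{v,v'\}\in\mathcal T$ there is more than one edge of $\Gamma$ between these two sets. The graph $\mathrm M(\Gamma,G)$ has vertex-set $\mathcal T$, with $\{u,u'\}$ and $\{v,v'\}$ adjacent iff some member of $\{u,u'\}$ is adjacent in $\Gamma$ to some member of $\{v,v'\}$. Let $\iota:\mathcal R\to E(\mathrm M(\Gamma,G))$, $\{u,v\}\mapsto\{\{u,u'\},\{v,v'\}\}$,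 and $\mathcal C(\Gamma,G)=\{\iota(C_1),\dots,\iota(C_n)\}$ (each $\iota(C_i)$ viewed as a set of edges). A cycle is a connected $2$-regular subgraph; a cycle decomposition of a graph is a set of cycles such that each edge lies in exactly one of them; it is $G$-arc-transitive if $G$ acts arc-transitively on the graph and maps each cycle of the decomposition to a cycle of the decomposition. $G$-arc-transitive means $G$ acts transitively on ordered pairs of adjacent vertices. *)

theory Defs
  imports "HOL-Algebra.Group_Action" "HOL-Combinatorics.Transposition"
begin

section \<open>Simple graphs\<close>

record 'a ugraph =
  verts :: "'a set"
  edges :: "'a set set"

definition simple_graph :: "'a ugraph \<Rightarrow> bool" where
  "simple_graph \<Gamma> \<longleftrightarrow> (\<forall>e \<in> edges \<Gamma>. e \<subseteq> verts \<Gamma> \<and> card e = 2)"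

definition nbhd :: "'a ugraph \<Rightarrow> 'a \<Rightarrow> 'a set" where
  "nbhd \<Gamma> v = {w. {v, w} \<in> edges \<Gamma>}"

definition regular_graph :: "nat \<Rightarrow> 'a ugraph \<Rightarrow> bool" where
  "regular_graph k \<Gamma> \<longleftrightarrow> (\<forall>v \<in> verts \<Gamma>. card (nbhd \<Gamma> v) = k)"

definition adj_rel :: "'a ugraph \<Rightarrow> ('a \<times> 'a) set" where
  "adj_rel \<Gamma> = {(u, v). {u, v} \<in> edges \<Gamma>}"

definition connected_graph :: "'a ugraph \<Rightarrow> bool" where
  "connected_graph \<Gamma> \<longleftrightarrow>
     verts \<Gamma> \<noteq> {} \<and> (\<forall>u \<in> verts \<Gamma>. \<forall>v \<in> verts \<Gamma>. (u, v) \<in> (adj_rel \<Gamma>)\<^sup>*)"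

definition subgraph_of :: "'a ugraph \<Rightarrow> 'a ugraph \<Rightarrow> bool" where
  "subgraph_of S \<Gamma> \<longleftrightarrow> simple_graph S \<and> verts S \<subseteq> verts \<Gamma> \<and> edges S \<subseteq> edges \<Gamma>"

definition induced_subgraph :: "'a ugraph \<Rightarrow> 'a set \<Rightarrow> 'a ugraph" where
  "induced_subgraph \<Gamma> W = \<lparr>verts = W, edges = {e \<in> edges \<Gamma>. e \<subseteq> W}\<rparr>"

definition components :: "'a ugraph \<Rightarrow> 'a ugraph set" where
  "components \<Gamma> =
     {induced_subgraph \<Gamma> {w \<in> verts \<Gamma>. (v, w) \<in> (adj_rel \<Gamma>)\<^sup>*} | v. v \<in> verts \<Gamma>}"

definition is_cycle_in :: "'a ugraph \<Rightarrow> 'a ugraph \<Rightarrow> bool" where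
  "is_cycle_in \<Gamma> S \<longleftrightarrow> subgraph_of S \<Gamma> \<and> connected_graph S \<and> regular_graph 2 S"

text \<open>The members of a cycle decomposition are given by their edge sets.\<close>

definition cycle_decomposition :: "'a ugraph \<Rightarrow> 'a set set set \<Rightarrow> bool" where
  "cycle_decomposition \<Gamma> \<C> \<longleftrightarrow>
     (\<forall>C \<in> \<C>. \<exists>S. is_cycle_in \<Gamma> S \<and> edges S = C) \<and>
     (\<forall>e \<in> edges \<Gamma>. \<exists>!C. C \<in> \<C> \<and> e \<in> C)"

section \<open>Automorphisms and group actions\<close>

text \<open>As for \<^const>\<open>BijGroup\<close>, automorphisms are extensional functions, so that
  they are determined by their values on vertices.\<close>

definition graph_auts :: "'a ugraph \<Rightarrow> ('a \<Rightarrow> 'a) set" where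
  "graph_auts \<Gamma> = {f \<in> Bij (verts \<Gamma>).
     \<forall>u \<in> verts \<Gamma>. \<forall>v \<in> verts \<Gamma>. {f u, f v} \<in> edges \<Gamma> \<longleftrightarrow> {u, v} \<in> edges \<Gamma>}"

definition aut_group :: "'a ugraph \<Rightarrow> ('a \<Rightarrow> 'a) monoid" where
  "aut_group \<Gamma> = BijGroup (verts \<Gamma>)\<lparr>carrier := graph_auts \<Gamma>\<rparr>"

text \<open>A set \<open>G\<close> of automorphisms, viewed as a group under composition.\<close>

abbreviation sub_aut :: "'a ugraph \<Rightarrow> ('a \<Rightarrow> 'a) set \<Rightarrow> ('a \<Rightarrow> 'a) monoid" where
  "sub_aut \<Gamma> G \<equiv> aut_group \<Gamma>\<lparr>carrier := G\<rparr>"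

definition acts_on_graph :: "('g, 'c) monoid_scheme \<Rightarrow> 'a ugraph \<Rightarrow> ('g \<Rightarrow> 'a \<Rightarrow> 'a) \<Rightarrow> bool" where
  "acts_on_graph H \<Gamma> \<phi> \<longleftrightarrow>
     group_action H (verts \<Gamma>) \<phi> \<and> (\<forall>g \<in> carrier H. \<phi> g \<in> graph_auts \<Gamma>)"

definition arc_transitive :: "('g, 'c) monoid_scheme \<Rightarrow> 'a ugraph \<Rightarrow> ('g \<Rightarrow> 'a \<Rightarrow> 'a) \<Rightarrow> bool" where
  "arc_transitive H \<Gamma> \<phi> \<longleftrightarrow> acts_on_graph H \<Gamma> \<phi> \<and>
     (\<forall>u v x y. {u, v} \<in> edges \<Gamma> \<longrightarrow> {x, y} \<in> edges \<Gamma> \<longrightarrow>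
        (\<exists>g \<in> carrier H. \<phi> g u = x \<and> \<phi> g v = y))"

definition preserves_cycles ::
  "('g, 'c) monoid_scheme \<Rightarrow> ('g \<Rightarrow> 'a \<Rightarrow> 'a) \<Rightarrow> 'a set set set \<Rightarrow> bool" where
  "preserves_cycles H \<phi> \<C> \<longleftrightarrow> (\<forall>g \<in> carrier H. \<forall>C \<in> \<C>. (\<lambda>e. \<phi> g ` e) ` C \<in> \<C>)"

definition arc_transitive_cycle_decomposition ::
  "('g, 'c) monoid_scheme \<Rightarrow> 'a ugraph \<Rightarrow> ('g \<Rightarrow> 'a \<Rightarrow> 'a) \<Rightarrow> 'a set set set \<Rightarrow> bool" where
  "arc_transitive_cycle_decomposition H \<Gamma> \<phi> \<C> \<longleftrightarrow>
     cycle_decomposition \<Gamma> \<C> \<and> arc_transitive H \<Gamma> \<phi> \<and> preserves_cycles H \<phi> \<C>"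

text \<open>Permutation groups are given by their sets of (extensional) permutations.\<close>

definition perm_isomorphic :: "'a set \<Rightarrow> ('a \<Rightarrow> 'a) set \<Rightarrow> 'b set \<Rightarrow> ('b \<Rightarrow> 'b) set \<Rightarrow> bool" where
  "perm_isomorphic A H B K \<longleftrightarrow>
     (\<exists>\<beta>. bij_betw \<beta> A B \<and> K = (\<lambda>h. \<lambda>x \<in> B. \<beta> (h (inv_into A \<beta> x))) ` H)"

section \<open>Locally-\<open>\<int>\<^sub>2\<close> cubic graphs\<close>

text \<open>The group of order 2 acting on 3 points: the identity and a transposition.\<close>

definition Z2_3 :: "(nat \<Rightarrow> nat) set" where
  "Z2_3 = {\<lambda>x \<in> {0, 1, 2}. x, \<lambda>x \<in> {0, 1, 2}. transpose 1 2 x}"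

abbreviation vstab :: "'a ugraph \<Rightarrow> ('a \<Rightarrow> 'a) set \<Rightarrow> 'a \<Rightarrow> ('a \<Rightarrow> 'a) set" where
  "vstab \<Gamma> G v \<equiv> stabilizer (sub_aut \<Gamma> G) (\<lambda>g. g) v"

definition local_group :: "'a ugraph \<Rightarrow> ('a \<Rightarrow> 'a) set \<Rightarrow> 'a \<Rightarrow> ('a \<Rightarrow> 'a) set" where
  "local_group \<Gamma> G v = (\<lambda>g. \<lambda>x \<in> nbhd \<Gamma> v. g x) ` vstab \<Gamma> G v"

text \<open>This is applied only to vertex-transitive \<open>G\<close>, where the choice of the vertex is irrelevant.\<close>

definition locally_Z2_3 :: "'a ugraph \<Rightarrow> ('a \<Rightarrow> 'a) set \<Rightarrow> bool" where
  "locally_Z2_3 \<Gamma> G \<longleftrightarrow>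
     (\<exists>v \<in> verts \<Gamma>. perm_isomorphic (nbhd \<Gamma> v) (local_group \<Gamma> G v) {0, 1, 2} Z2_3)"

text \<open>The partner of \<open>u\<close> is the neighbour \<open>u'\<close> fixed by the stabilizer of \<open>u\<close>.\<close>

definition partner :: "'a ugraph \<Rightarrow> ('a \<Rightarrow> 'a) set \<Rightarrow> 'a \<Rightarrow> 'a" where
  "partner \<Gamma> G u = (THE w. w \<in> nbhd \<Gamma> u \<and> (\<forall>g \<in> vstab \<Gamma> G u. g w = w))"

definition mpair :: "'a ugraph \<Rightarrow> ('a \<Rightarrow> 'a) set \<Rightarrow> 'a \<Rightarrow> 'a set" where
  "mpair \<Gamma> G u = {u, partner \<Gamma> G u}"

definition Tset :: "'a ugraph \<Rightarrow> ('a \<Rightarrow> 'a) set \<Rightarrow> 'a set set" where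
  "Tset \<Gamma> G = {mpair \<Gamma> G u | u. u \<in> verts \<Gamma>}"

definition Rset :: "'a ugraph \<Rightarrow> ('a \<Rightarrow> 'a) set \<Rightarrow> 'a set set" where
  "Rset \<Gamma> G = edges \<Gamma> - Tset \<Gamma> G"

definition edges_between :: "'a ugraph \<Rightarrow> 'a set \<Rightarrow> 'a set \<Rightarrow> 'a set set" where
  "edges_between \<Gamma> A B = {e \<in> edges \<Gamma>. \<exists>x \<in> A. \<exists>y \<in> B. e = {x, y}}"

definition degenerate :: "'a ugraph \<Rightarrow> ('a \<Rightarrow> 'a) set \<Rightarrow> bool" where
  "degenerate \<Gamma> G \<longleftrightarrow>
     (\<exists>a \<in> Tset \<Gamma> G. \<exists>b \<in> Tset \<Gamma> G. card (edges_between \<Gamma> a b) > 1)"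

text \<open>Distinctness of \<open>a\<close> and \<open>b\<close> is required for adjacency, as the graph is simple.\<close>

definition Mgraph :: "'a ugraph \<Rightarrow> ('a \<Rightarrow> 'a) set \<Rightarrow> 'a set ugraph" where
  "Mgraph \<Gamma> G =
     \<lparr>verts = Tset \<Gamma> G,
      edges = {{a, b} | a b. a \<in> Tset \<Gamma> G \<and> b \<in> Tset \<Gamma> G \<and> a \<noteq> b \<and>
                             (\<exists>x \<in> a. \<exists>y \<in> b. {x, y} \<in> edges \<Gamma>)}\<rparr>"

text \<open>The action on \<open>Mgraph \<Gamma> G\<close> induced by the action on the vertices of \<open>\<Gamma>\<close>.\<close>

definition Maction :: "'a ugraph \<Rightarrow> ('a \<Rightarrow> 'a) set \<Rightarrow> ('a \<Rightarrow> 'a) \<Rightarrow> 'a set \<Rightarrow> 'a set" where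
  "Maction \<Gamma> G g = (\<lambda>a \<in> Tset \<Gamma> G. g ` a)"

text \<open>\<open>iota\<close> sends the edge \<open>{u, v}\<close> to \<open>{{u, u'}, {v, v'}}\<close>.\<close>

definition iota :: "'a ugraph \<Rightarrow> ('a \<Rightarrow> 'a) set \<Rightarrow> 'a set \<Rightarrow> 'a set set" where
  "iota \<Gamma> G e = mpair \<Gamma> G ` e"

text \<open>The cycles \<open>C\<^sub>1, \<dots>, C\<^sub>n\<close> are the connected components of the spanning
  subgraph with edge set \<open>Rset \<Gamma> G\<close>.\<close>

definition Ccycles :: "'a ugraph \<Rightarrow> ('a \<Rightarrow> 'a) set \<Rightarrow> 'a set set set set" where
  "Ccycles \<Gamma> G =
     {iota \<Gamma> G ` edges C | C. C \<in> components \<lparr>verts = verts \<Gamma>, edges = Rset \<Gamma> G\<rparr>}"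

end

theory Submission
  imports Defs
begin

text \<open>
  The map \<open>u \<mapsto> u'\<close> commutes with \<open>G\<close>, hence is an involution, and \<open>G\<close> is transitive on the arcs
  of \<open>\<R>\<close>. Nondegeneracy says that every edge of \<open>M(\<Gamma>, G)\<close> lifts to a unique edge of \<open>\<R>\<close>, which
  gives valency 4, faithfulness and arc-transitivity. The images of the cycles of \<open>\<R>\<close> are again
  cycles because \<open>u\<close> and \<open>u'\<close> never lie on the same one: a one-step rotation in \<open>G\<close> of a common
  cycle would show that \<open>\<Gamma>\<close> is degenerate.
\<close>

section \<open>Components and images of graphs\<close>

text \<open>The map \<open>mpair\<close> is two-to-one, so a vertex of the quotient does not
  determine a vertex of \<open>\<Gamma>\<close>, and a cycle of R could a priori be folded onto
  itself. Unique lifting is therefore used in an ordered form: an R-edge is recovered end by end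
  from the pairs of its two ends. Applied to two images of one R-edge it separates elements of
  \<open>G\<close>; applied to the R-edges leaving a pair it counts neighbours.

  The cycles are never enumerated. They are components of a 2-regular graph, and the rotation that
  excludes folding is expressed by a condition on a vertex and its two neighbours, which spreads
  along reachability.

  Elements of \<open>G\<close> are extensional functions, so inverses and products are handled
  through equations that hold on vertices only.\<close>

lemma simple_graph_edgeD:
  assumes "simple_graph \<Gamma>" "{u, v} \<in> edges \<Gamma>"
  shows "u \<in> verts \<Gamma>" "v \<in> verts \<Gamma>" "u \<noteq> v"
  using assms by (auto simp: simple_graph_def)

lemma simple_graph_edgeE:
  assumes "simple_graph \<Gamma>" "e \<in> edges \<Gamma>"
  obtains u v where "e = {u, v}" "{u, v} \<in> edges \<Gamma>"
  using assms by (metis card_2_iff simple_graph_def)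

lemma reachable_sym: "(u, v) \<in> (adj_rel \<Gamma>)\<^sup>* \<Longrightarrow> (v, u) \<in> (adj_rel \<Gamma>)\<^sup>*"
proof -
  have "sym (adj_rel \<Gamma>)"
    by (auto simp: sym_def adj_rel_def insert_commute)
  then show "(u, v) \<in> (adj_rel \<Gamma>)\<^sup>* \<Longrightarrow> (v, u) \<in> (adj_rel \<Gamma>)\<^sup>*"
    by (meson sym_rtrancl symD)
qed

text \<open>The alternative \<open>f x = f y\<close> admits maps that collapse some edges, as
  \<open>mpair\<close> does with the edges joining partners.\<close>

lemma reachable_map:
  assumes "(u, v) \<in> (adj_rel \<Gamma>)\<^sup>*"
    and "\<And>x y. {x, y} \<in> edges \<Gamma> \<Longrightarrow> f x = f y \<or> {f x, f y} \<in> edges \<Delta>"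
  shows "(f u, f v) \<in> (adj_rel \<Delta>)\<^sup>*"
  using assms(1)
proof (induction rule: rtrancl_induct)
  case (step y z)
  then have "f y = f z \<or> (f y, f z) \<in> adj_rel \<Delta>"
    using assms(2)[of y z] by (auto simp: adj_rel_def)
  with step.IH show ?case
    by (metis rtrancl.rtrancl_into_rtrancl)
qed simp

definition component_of :: "'a ugraph \<Rightarrow> 'a \<Rightarrow> 'a ugraph" where
  "component_of \<Gamma> v = induced_subgraph \<Gamma> {w \<in> verts \<Gamma>. (v, w) \<in> (adj_rel \<Gamma>)\<^sup>*}"

lemma components_eq: "components \<Gamma> = component_of \<Gamma> ` verts \<Gamma>"
  by (auto simp: components_def component_of_def)

lemma verts_component_of: "verts (component_of \<Gamma> v) = {w \<in> verts \<Gamma>. (v, w) \<in> (adj_rel \<Gamma>)\<^sup>*}"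
  by (simp add: component_of_def induced_subgraph_def)

lemma component_of_cong: "(u, v) \<in> (adj_rel \<Gamma>)\<^sup>* \<Longrightarrow> component_of \<Gamma> u = component_of \<Gamma> v"
proof -
  assume *: "(u, v) \<in> (adj_rel \<Gamma>)\<^sup>*"
  have "(u, w) \<in> (adj_rel \<Gamma>)\<^sup>* \<longleftrightarrow> (v, w) \<in> (adj_rel \<Gamma>)\<^sup>*" for w
    using * reachable_sym[OF *] by (meson rtrancl_trans)
  then show ?thesis
    by (simp add: component_of_def)
qed

text \<open>Testing one end is enough, since the edge itself makes the other end reachable.\<close>

lemma edge_component_of_iff:
  assumes "simple_graph \<Gamma>"
  shows "{x, y} \<in> edges (component_of \<Gamma> v) \<longleftrightarrow> {x, y} \<in> edges \<Gamma> \<and> (v, x) \<in> (adj_rel \<Gamma>)\<^sup>*"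
proof -
  have "(v, y) \<in> (adj_rel \<Gamma>)\<^sup>*" if "{x, y} \<in> edges \<Gamma>" "(v, x) \<in> (adj_rel \<Gamma>)\<^sup>*"
    using that by (simp add: adj_rel_def rtrancl.rtrancl_into_rtrancl)
  then show ?thesis
    using simple_graph_edgeD[OF assms, of x y]
    by (auto simp: component_of_def induced_subgraph_def)
qed

lemma edges_component_of_subset: "edges (component_of \<Gamma> v) \<subseteq> edges \<Gamma>"
  by (auto simp: component_of_def induced_subgraph_def)

lemma subgraph_component_of: "simple_graph \<Gamma> \<Longrightarrow> subgraph_of (component_of \<Gamma> v) \<Gamma>"
  by (auto simp: subgraph_of_def component_of_def induced_subgraph_def simple_graph_def)

lemma connected_component_of:
  assumes "simple_graph \<Gamma>" "v \<in> verts \<Gamma>"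
  shows "connected_graph (component_of \<Gamma> v)"
proof -
  have *: "(v, w) \<in> (adj_rel (component_of \<Gamma> v))\<^sup>*" if "(v, w) \<in> (adj_rel \<Gamma>)\<^sup>*" for w
    using that
  proof (induction rule: rtrancl_induct)
    case (step y z)
    then have "(y, z) \<in> adj_rel (component_of \<Gamma> v)"
      by (simp add: adj_rel_def edge_component_of_iff[OF assms(1)])
    with step.IH show ?case
      by (rule rtrancl.rtrancl_into_rtrancl)
  qed simp
  have "(x, y) \<in> (adj_rel (component_of \<Gamma> v))\<^sup>*"
    if "x \<in> verts (component_of \<Gamma> v)" "y \<in> verts (component_of \<Gamma> v)" for x y
  proof (rule rtrancl_trans)
    show "(x, v) \<in> (adj_rel (component_of \<Gamma> v))\<^sup>*" "(v, y) \<in> (adj_rel (component_of \<Gamma> v))\<^sup>*"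
      using that by (simp_all add: verts_component_of * reachable_sym)
  qed
  moreover have "v \<in> verts (component_of \<Gamma> v)"
    using assms(2) by (simp add: verts_component_of)
  ultimately show ?thesis
    unfolding connected_graph_def by blast
qed

text \<open>A component contains all neighbours of its vertices, so neighbourhoods do not
  shrink.\<close>

lemma regular_component_of:
  assumes "simple_graph \<Gamma>" "regular_graph k \<Gamma>"
  shows "regular_graph k (component_of \<Gamma> v)"
proof -
  have "nbhd (component_of \<Gamma> v) x = nbhd \<Gamma> x" if "x \<in> verts (component_of \<Gamma> v)" for x
    using that by (auto simp: nbhd_def edge_component_of_iff[OF assms(1)] verts_component_of)
  with assms(2) show ?thesis
    by (simp add: regular_graph_def verts_component_of)
qed

lemma ex1_component_edge:
  assumes "simple_graph \<Gamma>" "e \<in> edges \<Gamma>"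
  shows "\<exists>!C. C \<in> components \<Gamma> \<and> e \<in> edges C"
proof -
  obtain x y where e: "e = {x, y}" "{x, y} \<in> edges \<Gamma>"
    using simple_graph_edgeE[OF assms] .
  have x: "x \<in> verts \<Gamma>"
    using simple_graph_edgeD[OF assms(1) e(2)] by simp
  show ?thesis
  proof (rule ex1I[of _ "component_of \<Gamma> x"])
    show "component_of \<Gamma> x \<in> components \<Gamma> \<and> e \<in> edges (component_of \<Gamma> x)"
      using e x by (simp add: components_eq edge_component_of_iff[OF assms(1)])
    show "C = component_of \<Gamma> x" if C: "C \<in> components \<Gamma> \<and> e \<in> edges C" for C
    proof -
      obtain v where "C = component_of \<Gamma> v"
        using C by (auto simp: components_eq)
      with C show ?thesis
        by (simp add: component_of_cong e edge_component_of_iff[OF assms(1)])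
    qed
  qed
qed

text \<open>Both \<open>g\<close> and its inverse \<open>h\<close> carry walks to walks, which gives
  the two inclusions. Only edge sets are compared, because the members of a cycle decomposition are
  edge sets.\<close>

lemma edges_component_of_image:
  assumes \<Gamma>: "simple_graph \<Gamma>"
    and g: "\<And>x y. {x, y} \<in> edges \<Gamma> \<Longrightarrow> {g x, g y} \<in> edges \<Gamma>"
    and h: "\<And>x y. {x, y} \<in> edges \<Gamma> \<Longrightarrow> {h x, h y} \<in> edges \<Gamma>"
    and gh: "\<And>x. x \<in> verts \<Gamma> \<Longrightarrow> g (h x) = x" "\<And>x. x \<in> verts \<Gamma> \<Longrightarrow> h (g x) = x"
    and v: "v \<in> verts \<Gamma>"
  shows "(`) g ` edges (component_of \<Gamma> v) = edges (component_of \<Gamma> (g v))"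
proof (intro subset_antisym subsetI)
  fix e assume "e \<in> (`) g ` edges (component_of \<Gamma> v)"
  then obtain f where f: "e = g ` f" "f \<in> edges (component_of \<Gamma> v)"
    by blast
  then obtain x y where xy: "f = {x, y}" "{x, y} \<in> edges \<Gamma>"
    by (meson \<Gamma> edges_component_of_subset simple_graph_edgeE subsetD)
  have "(v, x) \<in> (adj_rel \<Gamma>)\<^sup>*"
    using f(2) unfolding xy(1) edge_component_of_iff[OF \<Gamma>] ..
  then have "(g v, g x) \<in> (adj_rel \<Gamma>)\<^sup>*"
    by (rule reachable_map) (rule disjI2, rule g)
  moreover have "e = {g x, g y}" "{g x, g y} \<in> edges \<Gamma>"
    using f(1) xy(1) g[OF xy(2)] by simp_all
  ultimately show "e \<in> edges (component_of \<Gamma> (g v))"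
    by (simp add: edge_component_of_iff[OF \<Gamma>])
next
  fix e assume f: "e \<in> edges (component_of \<Gamma> (g v))"
  then obtain x y where xy: "e = {x, y}" "{x, y} \<in> edges \<Gamma>"
    by (meson \<Gamma> edges_component_of_subset simple_graph_edgeE subsetD)
  have "(g v, x) \<in> (adj_rel \<Gamma>)\<^sup>*"
    using f unfolding xy(1) edge_component_of_iff[OF \<Gamma>] ..
  then have "(h (g v), h x) \<in> (adj_rel \<Gamma>)\<^sup>*"
    by (rule reachable_map) (rule disjI2, rule h)
  then have "{h x, h y} \<in> edges (component_of \<Gamma> v)"
    unfolding gh(2)[OF v] using h[OF xy(2)] by (simp add: edge_component_of_iff[OF \<Gamma>])
  moreover have "g ` {h x, h y} = e"
    using xy(1) simple_graph_edgeD[OF \<Gamma> xy(2)] by (simp add: gh)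
  ultimately show "e \<in> (`) g ` edges (component_of \<Gamma> v)"
    by blast
qed

text \<open>For \<open>f = mpair \<Gamma> G\<close> the action on edges is
  \<open>iota \<Gamma> G\<close>, so the image of a component of R is a graph whose edge set belongs
  to \<open>Ccycles \<Gamma> G\<close>.\<close>

definition image_graph :: "('a \<Rightarrow> 'b) \<Rightarrow> 'a ugraph \<Rightarrow> 'b ugraph" where
  "image_graph f \<Gamma> = \<lparr>verts = f ` verts \<Gamma>, edges = (`) f ` edges \<Gamma>\<rparr>"

lemma image_graph_simps [simp]:
  "verts (image_graph f \<Gamma>) = f ` verts \<Gamma>"
  "edges (image_graph f \<Gamma>) = (`) f ` edges \<Gamma>"
  by (simp_all add: image_graph_def)

lemma simple_image_graph:
  assumes "simple_graph \<Gamma>" "inj_on f (verts \<Gamma>)"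
  shows "simple_graph (image_graph f \<Gamma>)"
  using assms by (auto simp: simple_graph_def card_image inj_on_subset)

lemma connected_image_graph:
  assumes "connected_graph \<Gamma>"
  shows "connected_graph (image_graph f \<Gamma>)"
proof -
  have "(f u, f v) \<in> (adj_rel (image_graph f \<Gamma>))\<^sup>*" if "(u, v) \<in> (adj_rel \<Gamma>)\<^sup>*" for u v
  proof (rule reachable_map[OF that])
    fix x y assume "{x, y} \<in> edges \<Gamma>"
    then have "f ` {x, y} \<in> edges (image_graph f \<Gamma>)"
      unfolding image_graph_simps by (rule imageI)
    then show "f x = f y \<or> {f x, f y} \<in> edges (image_graph f \<Gamma>)"
      by simp
  qed
  with assms show ?thesis
    by (auto simp: connected_graph_def)
qed

lemma regular_image_graph:
  assumes \<Gamma>: "simple_graph \<Gamma>" and f: "inj_on f (verts \<Gamma>)" and "regular_graph k \<Gamma>"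
  shows "regular_graph k (image_graph f \<Gamma>)"
proof -
  have "nbhd (image_graph f \<Gamma>) (f x) = f ` nbhd \<Gamma> x" if x: "x \<in> verts \<Gamma>" for x
  proof (intro subset_antisym subsetI)
    fix w assume "w \<in> nbhd (image_graph f \<Gamma>) (f x)"
    then obtain e where e: "e \<in> edges \<Gamma>" "{f x, w} = f ` e"
      by (auto simp: nbhd_def)
    obtain a b where ab: "e = {a, b}" "{a, b} \<in> edges \<Gamma>"
      using simple_graph_edgeE[OF \<Gamma> e(1)] .
    have "a \<in> verts \<Gamma>" "b \<in> verts \<Gamma>"
      using simple_graph_edgeD[OF \<Gamma> ab(2)] by simp_all
    then show "w \<in> f ` nbhd \<Gamma> x"
      using ab e x f by (auto simp: doubleton_eq_iff nbhd_def inj_on_eq_iff insert_commute)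
  next
    fix w assume "w \<in> f ` nbhd \<Gamma> x"
    then obtain y where "w = f y" "{x, y} \<in> edges \<Gamma>"
      by (auto simp: nbhd_def)
    then show "w \<in> nbhd (image_graph f \<Gamma>) (f x)"
      using imageI[of "{x, y}" "edges \<Gamma>" "(`) f"] by (simp add: nbhd_def)
  qed
  moreover have "inj_on f (nbhd \<Gamma> x)" for x
    using f simple_graph_edgeD[OF \<Gamma>] by (auto simp: nbhd_def inj_on_def)
  ultimately show ?thesis
    using assms(3) by (simp add: regular_graph_def card_image)
qed

section \<open>Partners and the two edge orbits\<close>

locale vertex_transitive_Z2 =
  fixes \<Gamma> :: "'a ugraph" and G :: "('a \<Rightarrow> 'a) set"
  assumes simple: "simple_graph \<Gamma>"
    and finite_verts: "finite (verts \<Gamma>)"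
    and connected: "connected_graph \<Gamma>"
    and subgroup_G: "subgroup G (aut_group \<Gamma>)"
    and transitive: "transitive_action (sub_aut \<Gamma> G) (verts \<Gamma>) (\<lambda>g. g)"
    and local_Z2: "locally_Z2_3 \<Gamma> G"
begin

interpretation act: transitive_action "sub_aut \<Gamma> G" "verts \<Gamma>" "\<lambda>g. g"
  by (rule transitive)

section \<open>Elements of \<open>G\<close> as functions on the vertices\<close>

lemma G_subset: "G \<subseteq> graph_auts \<Gamma>"
  using subgroup.subset[OF subgroup_G] by (simp add: aut_group_def)

lemma G_verts: "g \<in> G \<Longrightarrow> x \<in> verts \<Gamma> \<Longrightarrow> g x \<in> verts \<Gamma>"
  using act.element_image[of g x] by simp

lemma G_inj: "g \<in> G \<Longrightarrow> inj_on g (verts \<Gamma>)"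
  using act.inj_prop by simp

lemma G_transitiveE:
  assumes "x \<in> verts \<Gamma>" "y \<in> verts \<Gamma>"
  obtains g where "g \<in> G" "g x = y"
  using act.unique_orbit[OF assms] by auto

lemma G_mult:
  assumes "g \<in> G" "h \<in> G" "x \<in> verts \<Gamma>"
  shows "(g \<otimes>\<^bsub>aut_group \<Gamma>\<^esub> h) x = g (h x)"
  using act.composition_rule[of x g h] assms by simp

lemma G_multE:
  assumes "g \<in> G" "h \<in> G"
  obtains k where "k \<in> G" "\<And>x. x \<in> verts \<Gamma> \<Longrightarrow> k x = g (h x)"
  using subgroup.m_closed[OF subgroup_G assms] G_mult[OF assms] by blast

lemma G_invE:
  assumes "g \<in> G"
  obtains h where "h \<in> G" "\<And>x. x \<in> verts \<Gamma> \<Longrightarrow> h (g x) = x" "\<And>x. x \<in> verts \<Gamma> \<Longrightarrow> g (h x) = x"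
proof -
  interpret group "sub_aut \<Gamma> G"
    using act.group_hom by (simp add: group_hom_def)
  define h where "h = inv\<^bsub>sub_aut \<Gamma> G\<^esub> g"
  have h: "h \<in> G"
    using inv_closed[of g] assms by (simp add: h_def)
  have hg: "h (g x) = x" if "x \<in> verts \<Gamma>" for x
    using act.orbit_sym_aux[of g x] assms that by (simp add: h_def)
  \<comment> \<open>The left inverse law at \<open>h x\<close> reads
    \<open>h (g (h x)) = h x\<close>, and \<open>h\<close> is injective.\<close>
  have "g (h x) = x" if x: "x \<in> verts \<Gamma>" for x
    using hg[OF G_verts[OF h x]] hg[of "g (h x)"] G_inj[OF h] x G_verts[OF h x]
      G_verts[OF assms G_verts[OF h x]] by (metis inj_on_eq_iff)
  with h hg show thesis
    using that by blast
qed

lemma G_edge_iff: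
  assumes "g \<in> G" "u \<in> verts \<Gamma>" "v \<in> verts \<Gamma>"
  shows "{g u, g v} \<in> edges \<Gamma> \<longleftrightarrow> {u, v} \<in> edges \<Gamma>"
  using G_subset assms by (auto simp: graph_auts_def)

lemma nbhd_subset: "nbhd \<Gamma> v \<subseteq> verts \<Gamma>"
  using simple_graph_edgeD[OF simple] by (auto simp: nbhd_def)

lemma G_nbhd_iff:
  assumes "g \<in> G" "u \<in> verts \<Gamma>" "v \<in> verts \<Gamma>"
  shows "g v \<in> nbhd \<Gamma> (g u) \<longleftrightarrow> v \<in> nbhd \<Gamma> u"
  using G_edge_iff[OF assms] by (simp add: nbhd_def)

lemma G_nbhd:
  assumes g: "g \<in> G" and u: "u \<in> verts \<Gamma>"
  shows "nbhd \<Gamma> (g u) = g ` nbhd \<Gamma> u"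
proof (intro subset_antisym subsetI)
  fix w assume w: "w \<in> nbhd \<Gamma> (g u)"
  then have wV: "w \<in> verts \<Gamma>"
    using nbhd_subset by blast
  obtain h where h: "h \<in> G" "\<And>x. x \<in> verts \<Gamma> \<Longrightarrow> g (h x) = x"
    using G_invE[OF g] by metis
  then have "h w \<in> nbhd \<Gamma> u"
    using G_nbhd_iff[OF g u G_verts[OF h(1) wV]] w wV by simp
  then show "w \<in> g ` nbhd \<Gamma> u"
    using h(2)[OF wV] by (metis imageI)
next
  fix w assume "w \<in> g ` nbhd \<Gamma> u"
  then show "w \<in> nbhd \<Gamma> (g u)"
    using G_nbhd_iff[OF g u] nbhd_subset by blast
qed

section \<open>The action of a vertex stabilizer on the neighbourhood\<close>

text \<open>Every member of \<open>Z2_3\<close> fixes 0, and the transposition of 1 and 2 is one of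
  them. Pulled back along the inverse \<open>\<gamma>\<close> of the given bijection, the first fact
  says that the stabilizer of \<open>v\<close> fixes \<open>\<gamma> 0\<close>; the second yields an
  element of it that swaps \<open>\<gamma> 1\<close> and \<open>\<gamma> 2\<close>.\<close>

lemma local_structure_at:
  assumes "perm_isomorphic (nbhd \<Gamma> v) (local_group \<Gamma> G v) {0, 1, 2} Z2_3" "v \<in> verts \<Gamma>"
  shows "\<exists>a b c. nbhd \<Gamma> v = {a, b, c} \<and> distinct [a, b, c] \<and> (\<forall>g\<in>G. g v = v \<longrightarrow> g a = a) \<and>
    (\<exists>s\<in>G. s v = v \<and> s b = c \<and> s c = b)"
proof -
  let ?N = "nbhd \<Gamma> v"
  define T :: "nat set" where "T = {0, 1, 2}"
  obtain \<beta> where \<beta>: "bij_betw \<beta> ?N T"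
    and Z: "Z2_3 = (\<lambda>h. \<lambda>x\<in>T. \<beta> (h (inv_into ?N \<beta> x))) ` local_group \<Gamma> G v"
    using assms(1) unfolding perm_isomorphic_def T_def by blast
  define \<gamma> where "\<gamma> = inv_into ?N \<beta>"
  have \<gamma>: "bij_betw \<gamma> T ?N"
    using bij_betw_inv_into[OF \<beta>] by (simp add: \<gamma>_def)
  have \<gamma>T: "\<gamma> x \<in> ?N" if "x \<in> T" for x
    using \<gamma> that by (auto simp: bij_betw_def)
  have \<gamma>\<beta>: "\<gamma> (\<beta> x) = x" if "x \<in> ?N" for x
    using that bij_betw_inv_into_left[OF \<beta>] by (simp add: \<gamma>_def)
  have N: "?N = {\<gamma> 0, \<gamma> 1, \<gamma> 2}"
    using \<gamma> by (auto simp: bij_betw_def T_def)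
  have "distinct [\<gamma> 0, \<gamma> 1, \<gamma> 2]"
    using bij_betw_imp_inj_on[OF \<gamma>] by (auto simp: T_def inj_on_def)
  moreover have "g (\<gamma> 0) = \<gamma> 0" if g: "g \<in> G" "g v = v" for g
  proof -
    have "(\<lambda>x\<in>?N. g x) \<in> local_group \<Gamma> G v"
      using g by (auto simp: local_group_def stabilizer_def)
    then have "(\<lambda>x\<in>T. \<beta> ((\<lambda>x\<in>?N. g x) (\<gamma> x))) \<in> Z2_3"
      unfolding Z \<gamma>_def by (rule imageI)
    moreover have "f 0 = 0" if "f \<in> Z2_3" for f
      using that by (auto simp: Z2_3_def transpose_def)
    ultimately have "(\<lambda>x\<in>T. \<beta> ((\<lambda>x\<in>?N. g x) (\<gamma> x))) 0 = 0"
      by blast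
    then have "\<beta> (g (\<gamma> 0)) = 0"
      using \<gamma>T by (simp add: T_def)
    moreover have "g (\<gamma> 0) \<in> ?N"
      using G_nbhd[OF g(1) assms(2)] g(2) \<gamma>T[of 0] by (auto simp: T_def)
    ultimately show ?thesis
      using \<gamma>\<beta> by metis
  qed
  moreover have "\<exists>s\<in>G. s v = v \<and> s (\<gamma> 1) = \<gamma> 2 \<and> s (\<gamma> 2) = \<gamma> 1"
  proof -
    have "(\<lambda>x\<in>T. transpose 1 2 x) \<in> Z2_3"
      by (simp add: Z2_3_def T_def)
    then obtain h where h: "h \<in> local_group \<Gamma> G v"
      "(\<lambda>x\<in>T. transpose 1 2 x) = (\<lambda>x\<in>T. \<beta> (h (\<gamma> x)))"
      unfolding Z \<gamma>_def by blast
    then obtain s where s: "s \<in> G" "s v = v" "h = (\<lambda>x\<in>?N. s x)"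
      by (auto simp: local_group_def stabilizer_def)
    have "s (\<gamma> x) = \<gamma> (transpose 1 2 x)" if x: "x \<in> T" for x
    proof -
      have "s (\<gamma> x) \<in> ?N"
        using G_nbhd[OF s(1) assms(2)] s(2) \<gamma>T[OF x] by auto
      then show ?thesis
        using fun_cong[OF h(2), of x] x \<gamma>T[OF x] \<gamma>\<beta> s(3) by simp
    qed
    from this[of 1] this[of 2] s show ?thesis
      by (auto simp: T_def)
  qed
  ultimately show ?thesis
    using N by blast
qed

text \<open>The local hypothesis speaks of a single vertex \<open>w\<close>. Vertex-transitivity
  gives \<open>g\<close> with \<open>g w = v\<close>, and conjugation by \<open>g\<close> transports
  the structure.\<close>

lemma local_structure:
  assumes v: "v \<in> verts \<Gamma>"
  shows "\<exists>a b c. nbhd \<Gamma> v = {a, b, c} \<and> distinct [a, b, c] \<and> (\<forall>g\<in>G. g v = v \<longrightarrow> g a = a) \<and>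
    (\<exists>s\<in>G. s v = v \<and> s b = c \<and> s c = b)"
proof -
  obtain w where w: "w \<in> verts \<Gamma>"
    "perm_isomorphic (nbhd \<Gamma> w) (local_group \<Gamma> G w) {0, 1, 2} Z2_3"
    using local_Z2 unfolding locally_Z2_3_def by blast
  obtain a b c s where N: "nbhd \<Gamma> w = {a, b, c}" "distinct [a, b, c]"
    and a: "\<And>g. g \<in> G \<Longrightarrow> g w = w \<Longrightarrow> g a = a"
    and s: "s \<in> G" "s w = w" "s b = c" "s c = b"
    using local_structure_at[OF w(2,1)] by blast
  obtain g where g: "g \<in> G" "g w = v"
    using G_transitiveE[OF w(1) v] .
  obtain h where h: "h \<in> G" "\<And>x. x \<in> verts \<Gamma> \<Longrightarrow> h (g x) = x" "\<And>x. x \<in> verts \<Gamma> \<Longrightarrow> g (h x) = x"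
    using G_invE[OF g(1)] by metis
  have abc: "a \<in> verts \<Gamma>" "b \<in> verts \<Gamma>" "c \<in> verts \<Gamma>"
    using nbhd_subset N by blast+
  have hv: "h v = w"
    using g h w by auto
  \<comment> \<open>Used in both directions: \<open>h k g\<close> brings an element fixing
    \<open>v\<close> back to \<open>w\<close>, and \<open>g s h\<close> carries the swap
    \<open>s\<close> from \<open>w\<close> to \<open>v\<close>.\<close>
  have conj: "\<exists>k'\<in>G. \<forall>x\<in>verts \<Gamma>. k' x = g' (k (h' x))"
    if kgh: "k \<in> G" "g' \<in> G" "h' \<in> G" for k g' h'
  proof -
    obtain m where m: "m \<in> G" "\<And>x. x \<in> verts \<Gamma> \<Longrightarrow> m x = k (h' x)"
      using G_multE[OF kgh(1,3)] by metis
    obtain n where n: "n \<in> G" "\<And>x. x \<in> verts \<Gamma> \<Longrightarrow> n x = g' (m x)"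
      using G_multE[OF kgh(2) m(1)] by metis
    then show ?thesis
      using m by auto
  qed
  have "nbhd \<Gamma> v = {g a, g b, g c}"
    using G_nbhd[OF g(1) w(1)] N g(2) by simp
  moreover have "distinct [g a, g b, g c]"
    using N(2) abc G_inj[OF g(1)] by (auto simp: inj_on_eq_iff)
  moreover have "k (g a) = g a" if k: "k \<in> G" "k v = v" for k
  proof -
    obtain k' where k': "k' \<in> G" "\<And>x. x \<in> verts \<Gamma> \<Longrightarrow> k' x = h (k (g x))"
      using conj[OF k(1) h(1) g(1)] by blast
    then have "k' a = a"
      using a[of k'] w g(2) k(2) hv by simp
    then have "g (h (k (g a))) = g a"
      using k' abc by simp
    then show ?thesis
      using h(3) G_verts k(1) g(1) abc by metis
  qed
  moreover have "\<exists>s'\<in>G. s' v = v \<and> s' (g b) = g c \<and> s' (g c) = g b"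
  proof -
    obtain s' where s': "s' \<in> G" "\<And>x. x \<in> verts \<Gamma> \<Longrightarrow> s' x = g (s (h x))"
      using conj[OF s(1) g(1) h(1)] by blast
    then show ?thesis
      using h(2) v hv s g abc G_verts[OF g(1)] by (intro bexI[of _ s']) simp_all
  qed
  ultimately show ?thesis
    by blast
qed

section \<open>The partner map\<close>

abbreviation (input) p :: "'a \<Rightarrow> 'a" where
  "p \<equiv> partner \<Gamma> G"

text \<open>The local involution moves both other neighbours, so the description defining
  \<open>partner\<close> has exactly one solution.\<close>

lemma partner_eqI:
  assumes v: "v \<in> verts \<Gamma>" and w: "w \<in> nbhd \<Gamma> v" "\<And>g. g \<in> G \<Longrightarrow> g v = v \<Longrightarrow> g w = w"
  shows "p v = w"
proof -
  obtain a b c s where N: "nbhd \<Gamma> v = {a, b, c}" "distinct [a, b, c]"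
    and s: "s \<in> G" "s v = v" "s b = c" "s c = b"
    using local_structure[OF v] by blast
  have *: "x = a" if "x \<in> nbhd \<Gamma> v \<and> (\<forall>g\<in>vstab \<Gamma> G v. g x = x)" for x
    using that N s by (auto simp: stabilizer_def)
  have w': "w \<in> nbhd \<Gamma> v \<and> (\<forall>g\<in>vstab \<Gamma> G v. g w = w)"
    using w by (auto simp: stabilizer_def)
  show ?thesis
    unfolding partner_def by (rule the_equality) (use w' * in auto)
qed

lemma partner_structure:
  assumes v: "v \<in> verts \<Gamma>"
  obtains b c s where "nbhd \<Gamma> v = {p v, b, c}" "distinct [p v, b, c]"
    "s \<in> G" "s v = v" "s b = c" "s c = b"
proof -
  obtain a b c s where N: "nbhd \<Gamma> v = {a, b, c}" "distinct [a, b, c]"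
    and a: "\<And>g. g \<in> G \<Longrightarrow> g v = v \<Longrightarrow> g a = a"
    and s: "s \<in> G" "s v = v" "s b = c" "s c = b"
    using local_structure[OF v] by blast
  have "p v = a"
    using partner_eqI[OF v, of a] N a by blast
  then show thesis
    using that N s by blast
qed

lemma partner_fixed:
  assumes v: "v \<in> verts \<Gamma>" and g: "g \<in> G" "g v = v"
  shows "g (p v) = p v"
proof -
  obtain a b c where N: "nbhd \<Gamma> v = {a, b, c}"
    and a: "\<And>g. g \<in> G \<Longrightarrow> g v = v \<Longrightarrow> g a = a"
    using local_structure[OF v] by blast
  have "p v = a"
    using partner_eqI[OF v, of a] N a by blast
  then show ?thesis
    using a g by simp
qed

lemma partner_nbhd: "v \<in> verts \<Gamma> \<Longrightarrow> p v \<in> nbhd \<Gamma> v"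
  by (metis insertI1 partner_structure)

lemma partner_verts: "v \<in> verts \<Gamma> \<Longrightarrow> p v \<in> verts \<Gamma>"
  using partner_nbhd nbhd_subset by blast

lemma partner_edge: "v \<in> verts \<Gamma> \<Longrightarrow> {v, p v} \<in> edges \<Gamma>"
  using partner_nbhd by (simp add: nbhd_def)

lemma partner_neq: "v \<in> verts \<Gamma> \<Longrightarrow> p v \<noteq> v"
  using simple_graph_edgeD(3)[OF simple partner_edge] by metis

text \<open>If \<open>k\<close> fixes \<open>g u\<close>, its conjugate \<open>n = h k g\<close>,
  with \<open>h\<close> inverse to \<open>g\<close>, fixes \<open>u\<close> and hence
  \<open>p u\<close>; so \<open>k\<close> fixes \<open>g (p u)\<close>, a neighbour of
  \<open>g u\<close>.\<close>

lemma partner_equivariant: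
  assumes g: "g \<in> G" and u: "u \<in> verts \<Gamma>"
  shows "p (g u) = g (p u)"
proof (rule partner_eqI)
  show "g u \<in> verts \<Gamma>" "g (p u) \<in> nbhd \<Gamma> (g u)"
    using G_verts[OF g u] G_nbhd[OF g u] partner_nbhd[OF u] by simp_all
  fix k assume k: "k \<in> G" "k (g u) = g u"
  obtain h where h: "h \<in> G" "\<And>x. x \<in> verts \<Gamma> \<Longrightarrow> h (g x) = x" "\<And>x. x \<in> verts \<Gamma> \<Longrightarrow> g (h x) = x"
    using G_invE[OF g] by metis
  obtain m where m: "m \<in> G" "\<And>x. x \<in> verts \<Gamma> \<Longrightarrow> m x = k (g x)"
    using G_multE[OF k(1) g] by metis
  obtain n where n: "n \<in> G" "\<And>x. x \<in> verts \<Gamma> \<Longrightarrow> n x = h (m x)"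
    using G_multE[OF h(1) m(1)] by metis
  have "n u = u"
    using n m k h u by simp
  then have "h (k (g (p u))) = p u"
    using partner_fixed[OF u n(1)] n m partner_verts[OF u] by simp
  then show "k (g (p u)) = g (p u)"
    using h(3) G_verts[OF k(1) G_verts[OF g partner_verts[OF u]]] by metis
qed

text \<open>An equivariant self-map of a finite transitive set is onto, hence injective, so the
  stabilizer of \<open>p u\<close> fixes \<open>u\<close>.\<close>

lemma partner_partner:
  assumes u: "u \<in> verts \<Gamma>"
  shows "p (p u) = u"
proof -
  have "verts \<Gamma> \<subseteq> p ` verts \<Gamma>"
  proof
    fix w assume "w \<in> verts \<Gamma>"
    then obtain g where "g \<in> G" "g (p u) = w"
      using G_transitiveE partner_verts[OF u] by metis
    then show "w \<in> p ` verts \<Gamma>"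
      using partner_equivariant[of g u] G_verts[of g u] u by (metis imageI)
  qed
  then have "p ` verts \<Gamma> = verts \<Gamma>"
    using partner_verts by blast
  then have inj: "inj_on p (verts \<Gamma>)"
    using finite_verts by (simp add: eq_card_imp_inj_on)
  show ?thesis
  proof (rule partner_eqI)
    show "p u \<in> verts \<Gamma>" "u \<in> nbhd \<Gamma> (p u)"
      using partner_verts[OF u] partner_edge[OF u] by (simp_all add: nbhd_def insert_commute)
    fix g assume g: "g \<in> G" "g (p u) = p u"
    then show "g u = u"
      using partner_equivariant[OF g(1) u] inj G_verts[OF g(1) u] u by (metis inj_on_eq_iff)
  qed
qed

section \<open>The pairs and the 2-regular graph of R-edges\<close>

lemma mpair_eq_iff:
  assumes "u \<in> verts \<Gamma>" "v \<in> verts \<Gamma>"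
  shows "mpair \<Gamma> G u = mpair \<Gamma> G v \<longleftrightarrow> v = u \<or> v = p u"
  using assms partner_partner by (auto simp: mpair_def doubleton_eq_iff)

lemma mpair_partner: "u \<in> verts \<Gamma> \<Longrightarrow> mpair \<Gamma> G (p u) = mpair \<Gamma> G u"
  using mpair_eq_iff partner_verts by metis

lemma Tset_eq: "Tset \<Gamma> G = mpair \<Gamma> G ` verts \<Gamma>"
  by (auto simp: Tset_def)

text \<open>As the partner map is an involution, a pair is \<open>mpair\<close> of either of its
  members; hence distinct pairs are disjoint.\<close>

lemma mem_TsetD:
  assumes "a \<in> Tset \<Gamma> G" "x \<in> a"
  shows "x \<in> verts \<Gamma>" "a = mpair \<Gamma> G x"
  using assms partner_verts mpair_partner by (auto simp: Tset_eq mpair_def)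

lemma image_mpair:
  "g \<in> G \<Longrightarrow> u \<in> verts \<Gamma> \<Longrightarrow> g ` mpair \<Gamma> G u = mpair \<Gamma> G (g u)"
  by (simp add: mpair_def partner_equivariant)

text \<open>The condition looks one-sided, but a pair containing \<open>u\<close> can only be
  \<open>mpair \<Gamma> G u\<close>, so it does not matter which end is called
  \<open>u\<close>.\<close>

lemma Rset_iff: "{u, v} \<in> Rset \<Gamma> G \<longleftrightarrow> {u, v} \<in> edges \<Gamma> \<and> v \<noteq> p u"
proof -
  have "{u, v} \<in> Tset \<Gamma> G \<longleftrightarrow> v = p u" if "{u, v} \<in> edges \<Gamma>"
  proof
    have uv: "u \<in> verts \<Gamma>" "u \<noteq> v"
      using simple_graph_edgeD[OF simple that] by auto
    show "v = p u" if "{u, v} \<in> Tset \<Gamma> G"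
      using mem_TsetD(2)[OF that, of u] uv by (auto simp: mpair_def doubleton_eq_iff)
    show "{u, v} \<in> Tset \<Gamma> G" if "v = p u"
      using that uv by (auto simp: Tset_eq mpair_def)
  qed
  then show ?thesis
    by (auto simp: Rset_def)
qed

abbreviation Rgraph :: "'a ugraph" where
  "Rgraph \<equiv> \<lparr>verts = verts \<Gamma>, edges = Rset \<Gamma> G\<rparr>"

lemma simple_Rgraph: "simple_graph Rgraph"
  using simple by (auto simp: simple_graph_def Rset_def)

lemmas Rset_edgeD = simple_graph_edgeD[OF simple_Rgraph, simplified]

lemma mpair_neq: "{u, v} \<in> Rset \<Gamma> G \<Longrightarrow> mpair \<Gamma> G u \<noteq> mpair \<Gamma> G v"
  using Rset_iff Rset_edgeD mpair_eq_iff by metis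

lemma G_Rset:
  assumes "g \<in> G" "{u, v} \<in> Rset \<Gamma> G"
  shows "{g u, g v} \<in> Rset \<Gamma> G"
proof -
  have uv: "u \<in> verts \<Gamma>" "v \<in> verts \<Gamma>"
    using Rset_edgeD[OF assms(2)] by auto
  then have "g v \<noteq> g (p u)"
    using assms G_inj[OF assms(1)] partner_verts by (auto simp: Rset_iff inj_on_eq_iff)
  then show ?thesis
    using assms uv G_edge_iff partner_equivariant by (auto simp: Rset_iff)
qed

lemma Rset_structure:
  assumes v: "v \<in> verts \<Gamma>"
  obtains b c s where "nbhd Rgraph v = {b, c}" "b \<noteq> c" "s \<in> G" "s v = v" "s b = c" "s c = b"
proof -
  obtain b c s where N: "nbhd \<Gamma> v = {p v, b, c}" "distinct [p v, b, c]"
    and s: "s \<in> G" "s v = v" "s b = c" "s c = b"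
    using partner_structure[OF v] .
  have "nbhd Rgraph v = nbhd \<Gamma> v - {p v}"
    by (auto simp: nbhd_def Rset_iff)
  then have "nbhd Rgraph v = {b, c}"
    using N by auto
  then show thesis
    using that N s by auto
qed

lemma regular_Rgraph: "regular_graph 2 Rgraph"
proof -
  have "card (nbhd Rgraph v) = 2" if v: "v \<in> verts \<Gamma>" for v
    using Rset_structure[OF v] by (metis card_2_iff)
  then show ?thesis
    by (simp add: regular_graph_def)
qed

text \<open>After \<open>u\<close> has been moved to \<open>x\<close>, the image of \<open>v\<close>
  is one of the two R-neighbours of \<open>x\<close>; if it is the wrong one, the local involution
  at \<open>x\<close> corrects it.\<close>

lemma Rset_arc_transitive:
  assumes uv: "{u, v} \<in> Rset \<Gamma> G" and xy: "{x, y} \<in> Rset \<Gamma> G"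
  obtains g where "g \<in> G" "g u = x" "g v = y"
proof -
  have V: "u \<in> verts \<Gamma>" "v \<in> verts \<Gamma>" "x \<in> verts \<Gamma>"
    using Rset_edgeD uv xy by auto
  obtain g where g: "g \<in> G" "g u = x"
    using G_transitiveE V by metis
  obtain b c s where N: "nbhd Rgraph x = {b, c}" and s: "s \<in> G" "s x = x" "s b = c" "s c = b"
    using Rset_structure[OF V(3)] .
  have "g v \<in> {b, c}" "y \<in> {b, c}"
    using G_Rset[OF g(1) uv] xy g(2) N by (auto simp: nbhd_def)
  then consider "g v = y" | "s (g v) = y"
    using s by auto
  then show thesis
  proof cases
    case 1
    then show thesis using that g by blast
  next
    case 2
    obtain k where "k \<in> G" "\<And>x. x \<in> verts \<Gamma> \<Longrightarrow> k x = s (g x)"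
      using G_multE[OF s(1) g(1)] by metis
    then show thesis
      using that V 2 s g by metis
  qed
qed

end

section \<open>The quotient graph\<close>

locale nondegenerate_Z2 = vertex_transitive_Z2 +
  assumes nondegenerate: "\<not> degenerate \<Gamma> G"
begin

section \<open>Unique lifting and the cycles of R\<close>

lemma finite_edges: "finite (edges \<Gamma>)"
  using simple finite_verts
  by (intro finite_subset[of "edges \<Gamma>" "Pow (verts \<Gamma>)"]) (auto simp: simple_graph_def)

text \<open>Both edges run between the same two pairs, where nondegeneracy allows only one. This is
  the only direct appeal to nondegeneracy; everything later goes through this lemma.\<close>

lemma Rset_lift_unique:
  assumes e: "{x, y} \<in> Rset \<Gamma> G" and f: "{u, v} \<in> Rset \<Gamma> G"
    and eq: "mpair \<Gamma> G x = mpair \<Gamma> G u" "mpair \<Gamma> G y = mpair \<Gamma> G v"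
  shows "x = u \<and> y = v"
proof -
  let ?E = "edges_between \<Gamma> (mpair \<Gamma> G u) (mpair \<Gamma> G v)"
  have "x \<in> mpair \<Gamma> G x" "y \<in> mpair \<Gamma> G y" "u \<in> mpair \<Gamma> G u" "v \<in> mpair \<Gamma> G v"
    by (simp_all add: mpair_def)
  then have sub: "{{x, y}, {u, v}} \<subseteq> ?E"
    using e f unfolding eq by (auto simp: edges_between_def Rset_def)
  \<comment> \<open>An infinite set has \<open>card\<close> 0, so the bound from nondegeneracy is
    informative only for a finite \<open>?E\<close>.\<close>
  have "finite ?E"
    using finite_edges by (simp add: edges_between_def)
  moreover have "\<not> card ?E > 1"
    using nondegenerate Rset_edgeD[OF f] by (auto simp: degenerate_def Tset_eq)
  ultimately have "{x, y} = {u, v}"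
    using sub card_mono[of ?E "{{x, y}, {u, v}}"] by (cases "{x, y} = {u, v}") auto
  \<comment> \<open>This excludes the crossed match of ends: \<open>x = v\<close> would put
    \<open>u\<close> and \<open>v\<close> in the same pair.\<close>
  moreover have "x \<noteq> v"
    using mpair_neq[OF f] eq by auto
  ultimately show ?thesis
    by (auto simp: doubleton_eq_iff)
qed

lemma inj_on_iota: "inj_on (iota \<Gamma> G) (Rset \<Gamma> G)"
proof (rule inj_onI)
  fix e f assume e: "e \<in> Rset \<Gamma> G" and f: "f \<in> Rset \<Gamma> G" and eq: "iota \<Gamma> G e = iota \<Gamma> G f"
  obtain x y where xy: "e = {x, y}" "{x, y} \<in> Rset \<Gamma> G"
    using simple_graph_edgeE[OF simple_Rgraph, of e] e by auto
  obtain u v where uv: "f = {u, v}" "{u, v} \<in> Rset \<Gamma> G"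
    using simple_graph_edgeE[OF simple_Rgraph, of f] f by auto
  \<comment> \<open>Equal images may match the ends straight or crossed; the reversed edge covers
    the crossed case.\<close>
  have vu: "{v, u} \<in> Rset \<Gamma> G"
    using uv(2) by (simp add: insert_commute)
  show "e = f"
    using eq Rset_lift_unique[OF xy(2) uv(2)] Rset_lift_unique[OF xy(2) vu]
    by (auto simp: iota_def xy(1) uv(1) doubleton_eq_iff)
qed

lemma Rset_neighbours:
  assumes "{x, a} \<in> Rset \<Gamma> G" "{x, b} \<in> Rset \<Gamma> G" "a \<noteq> b" "{x, c} \<in> Rset \<Gamma> G"
  shows "c = a \<or> c = b"
proof -
  obtain b' c' where "nbhd Rgraph x = {b', c'}"
    using Rset_structure[of x] Rset_edgeD(1)[OF assms(1)] by metis
  then have "a \<in> {b', c'}" "b \<in> {b', c'}" "c \<in> {b', c'}"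
    using assms by (auto simp: nbhd_def)
  with assms(3) show ?thesis
    by auto
qed

text \<open>With \<open>x\<close> left arbitrary, this merely supplies an R-neighbour.\<close>

lemma Rset_other_neighbour:
  assumes "v \<in> verts \<Gamma>"
  obtains w where "{v, w} \<in> Rset \<Gamma> G" "w \<noteq> x"
proof -
  obtain b c where "nbhd Rgraph v = {b, c}" "b \<noteq> c"
    using Rset_structure[OF assms] .
  then have "{v, b} \<in> Rset \<Gamma> G" "{v, c} \<in> Rset \<Gamma> G" "b \<noteq> x \<or> c \<noteq> x"
    by (auto simp: nbhd_def)
  then show thesis
    using that by blast
qed

text \<open>Otherwise let \<open>g\<close> rotate the cycle through \<open>u\<close> by one step, from \<open>u\<close> to its neighbour \<open>v\<close>.
  As \<open>p u\<close> lies on the same cycle, it is adjacent to \<open>g (p u) = p v\<close>, so that \<open>{u, v}\<close> and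
  \<open>{p u, p v}\<close> are two edges between the same pairs.\<close>

lemma partner_unreachable:
  assumes u: "u \<in> verts \<Gamma>"
  shows "(u, p u) \<notin> (adj_rel Rgraph)\<^sup>*"
proof
  assume reach: "(u, p u) \<in> (adj_rel Rgraph)\<^sup>*"
  obtain v where uv: "{u, v} \<in> Rset \<Gamma> G"
    using Rset_other_neighbour[OF u] .
  have vu: "{v, u} \<in> Rset \<Gamma> G"
    using uv by (simp add: insert_commute)
  \<comment> \<open>Choosing \<open>w \<noteq> u\<close> makes \<open>g\<close> move the arc from
    \<open>u\<close> to \<open>v\<close> onto the next one, from \<open>v\<close> to
    \<open>w\<close>, instead of reversing the edge.\<close>
  obtain w where vw: "{v, w} \<in> Rset \<Gamma> G" "w \<noteq> u"
    using Rset_other_neighbour[OF Rset_edgeD(2)[OF uv]] .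
  obtain g where g: "g \<in> G" "g u = v" "g v = w"
    using Rset_arc_transitive[OF uv vw(1)] .
  have inj: "a = b" if "g a = g b" "a \<in> verts \<Gamma>" "b \<in> verts \<Gamma>" for a b
    using that G_inj[OF g(1)] by (simp add: inj_on_eq_iff)
  \<comment> \<open>\<open>P x\<close> says that \<open>g\<close> acts at \<open>x\<close> as a
    one-step rotation. The second conjunct, on the neighbour behind \<open>x\<close>, is what lets
    the property spread against the direction of rotation.\<close>
  define P where "P x \<longleftrightarrow> {x, g x} \<in> Rset \<Gamma> G \<and>
    (\<forall>y. {x, y} \<in> Rset \<Gamma> G \<and> y \<noteq> g x \<longrightarrow> g y = x)" for x
  have "g y = u" if y: "{u, y} \<in> Rset \<Gamma> G" "y \<noteq> g u" for y
  proof -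
    have "{v, g y} \<in> Rset \<Gamma> G"
      using G_Rset[OF g(1) y(1)] g by simp
    then have "g y = u \<or> g y = w"
      using Rset_neighbours[OF vu vw(1)] vw(2) by blast
    moreover have "g y \<noteq> w"
      using inj[of y v] y g Rset_edgeD uv by auto
    ultimately show ?thesis
      by blast
  qed
  then have base: "P u"
    using uv g by (simp add: P_def)
  have step: "P z" if x: "P x" and xz: "{x, z} \<in> Rset \<Gamma> G" for x z
  proof (cases "z = g x")
    case True
    have xgx: "{g x, x} \<in> Rset \<Gamma> G" "{x, g x} \<in> Rset \<Gamma> G"
      using x by (simp_all add: P_def insert_commute)
    have V: "x \<in> verts \<Gamma>" "g x \<in> verts \<Gamma>"
      using Rset_edgeD xgx by auto
    have gg: "{g x, g (g x)} \<in> Rset \<Gamma> G"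
      using G_Rset[OF g(1) xgx(2)] .
    \<comment> \<open>Here \<open>t\<close> lies behind \<open>x\<close>, so \<open>g t = x\<close>.
      As \<open>t \<noteq> g x\<close>, injectivity gives \<open>g (g x) \<noteq> x\<close>, and
      these two are all R-neighbours of \<open>g x\<close>.\<close>
    obtain t where t: "{x, t} \<in> Rset \<Gamma> G" "t \<noteq> g x"
      using Rset_other_neighbour[OF V(1)] .
    then have "g t = x"
      using x by (simp add: P_def)
    then have "x \<noteq> g (g x)"
      using inj[of t "g x"] t Rset_edgeD(2)[OF t(1)] V by auto
    then have "y = x" if "{g x, y} \<in> Rset \<Gamma> G" "y \<noteq> g (g x)" for y
      using Rset_neighbours[OF xgx(1) gg _ that(1)] that(2) by blast
    then show ?thesis
      using True gg by (auto simp: P_def)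
  next
    case False
    have xgx: "{x, g x} \<in> Rset \<Gamma> G"
      using x by (simp add: P_def)
    have gz: "g z = x"
      using x xz False by (simp add: P_def)
    \<comment> \<open>Now \<open>z\<close> lies behind \<open>x\<close>. The image of its other
      neighbour is an R-neighbour of \<open>x\<close> different from \<open>g x\<close>, which
      leaves only \<open>z\<close>.\<close>
    have "g y = z" if y: "{z, y} \<in> Rset \<Gamma> G" "y \<noteq> x" for y
    proof -
      have "{x, g y} \<in> Rset \<Gamma> G"
        using G_Rset[OF g(1) y(1)] gz by simp
      then have "g y = g x \<or> g y = z"
        using Rset_neighbours[OF xgx xz] False by blast
      moreover have "g y \<noteq> g x"
        using inj[of y x] y Rset_edgeD(1)[OF xz] Rset_edgeD(2)[OF y(1)] by blast
      ultimately show ?thesis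
        by blast
    qed
    then show ?thesis
      using xz gz by (auto simp: P_def insert_commute)
  qed
  have "P (p u)"
    using reach
  proof (induction rule: rtrancl_induct)
    case (step y z)
    then show ?case
      using \<open>P y \<Longrightarrow> {y, z} \<in> Rset \<Gamma> G \<Longrightarrow> P z\<close> by (simp add: adj_rel_def)
  qed (rule base)
  then have "{p u, p v} \<in> Rset \<Gamma> G"
    using partner_equivariant[OF g(1) u] g(2) by (simp add: P_def)
  then have "p u = u"
    using Rset_lift_unique[OF _ uv] mpair_partner u Rset_edgeD(2)[OF uv] by blast
  with partner_neq[OF u] show False
    by blast
qed

lemma inj_on_mpair_component: "inj_on (mpair \<Gamma> G) (verts (component_of Rgraph v))"
proof (rule inj_onI)
  fix x y assume x: "x \<in> verts (component_of Rgraph v)" and y: "y \<in> verts (component_of Rgraph v)"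
    and eq: "mpair \<Gamma> G x = mpair \<Gamma> G y"
  have xy: "x \<in> verts \<Gamma>" "y \<in> verts \<Gamma>"
    "(v, x) \<in> (adj_rel Rgraph)\<^sup>*" "(v, y) \<in> (adj_rel Rgraph)\<^sup>*"
    using x y by (simp_all add: verts_component_of)
  then have "(x, y) \<in> (adj_rel Rgraph)\<^sup>*"
    using reachable_sym rtrancl_trans by metis
  then have "y \<noteq> p x"
    using partner_unreachable[OF xy(1)] by metis
  then show "x = y"
    using eq mpair_eq_iff[OF xy(1,2)] by simp
qed

section \<open>Order, valency and connectedness of the quotient\<close>

abbreviation M :: "'a set ugraph" where
  "M \<equiv> Mgraph \<Gamma> G"

lemma verts_M: "verts M = mpair \<Gamma> G ` verts \<Gamma>"
  by (simp add: Mgraph_def Tset_eq)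

lemma M_edgeI: "{x, y} \<in> Rset \<Gamma> G \<Longrightarrow> {mpair \<Gamma> G x, mpair \<Gamma> G y} \<in> edges M"
  using mpair_neq[of x y] Rset_edgeD[of x y]
  by (auto simp: Mgraph_def Tset_eq Rset_iff mpair_def)

text \<open>An edge of \<open>\<Gamma>\<close> between distinct pairs does not join partners, so it
  is in R. The lift respects the order of \<open>a\<close> and \<open>b\<close>, which
  arc-transitivity requires.\<close>

lemma M_edgeE:
  assumes "{a, b} \<in> edges M"
  obtains x y where "{x, y} \<in> Rset \<Gamma> G" "a = mpair \<Gamma> G x" "b = mpair \<Gamma> G y"
proof -
  have lift: "\<exists>x y. {x, y} \<in> Rset \<Gamma> G \<and> c = mpair \<Gamma> G x \<and> d = mpair \<Gamma> G y"
    if cd: "c \<in> Tset \<Gamma> G" "d \<in> Tset \<Gamma> G" "c \<noteq> d" "x \<in> c" "y \<in> d" "{x, y} \<in> edges \<Gamma>" for c d x y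
  proof -
    have x: "x \<in> verts \<Gamma>" "c = mpair \<Gamma> G x" and y: "y \<in> verts \<Gamma>" "d = mpair \<Gamma> G y"
      using mem_TsetD cd by metis+
    then have "y \<noteq> p x"
      using cd(3) mpair_partner by metis
    then show ?thesis
      using x y cd(6) Rset_iff by blast
  qed
  obtain c d x y where cd: "{a, b} = {c, d}" "c \<in> Tset \<Gamma> G" "d \<in> Tset \<Gamma> G" "c \<noteq> d"
    "x \<in> c" "y \<in> d" "{x, y} \<in> edges \<Gamma>"
    using assms by (auto simp: Mgraph_def)
  have "{y, x} \<in> edges \<Gamma>"
    using cd(7) by (simp add: insert_commute)
  then show thesis
    using that lift[OF cd(2-7)] lift[OF cd(3,2) cd(4)[symmetric] cd(6,5)] cd(1)
    by (metis doubleton_eq_iff)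
qed

text \<open>With \<open>inj_on_iota\<close> this makes \<open>iota \<Gamma> G\<close> a bijection
  from R onto the edges of \<open>M\<close>, through which the partition of R into components is
  transported.\<close>

lemma edges_M: "edges M = iota \<Gamma> G ` Rset \<Gamma> G"
proof (intro subset_antisym subsetI)
  fix e assume e: "e \<in> edges M"
  then obtain a b where ab: "e = {a, b}"
    by (auto simp: Mgraph_def)
  then obtain x y where "{x, y} \<in> Rset \<Gamma> G" "a = mpair \<Gamma> G x" "b = mpair \<Gamma> G y"
    using M_edgeE e by metis
  moreover from this have "e = iota \<Gamma> G {x, y}"
    by (simp add: ab iota_def)
  ultimately show "e \<in> iota \<Gamma> G ` Rset \<Gamma> G"
    by blast
next
  fix e assume "e \<in> iota \<Gamma> G ` Rset \<Gamma> G"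
  then obtain f where f: "f \<in> Rset \<Gamma> G" "e = iota \<Gamma> G f"
    by blast
  then obtain x y where "f = {x, y}" "{x, y} \<in> Rset \<Gamma> G"
    using simple_graph_edgeE[OF simple_Rgraph, of f] by auto
  then show "e \<in> edges M"
    using f M_edgeI by (simp add: iota_def)
qed

lemma simple_M: "simple_graph M"
  by (auto simp: simple_graph_def Mgraph_def intro!: card_2_iff[THEN iffD2])

lemma connected_M: "connected_graph M"
proof -
  have "(mpair \<Gamma> G u, mpair \<Gamma> G v) \<in> (adj_rel M)\<^sup>*" if "u \<in> verts \<Gamma>" "v \<in> verts \<Gamma>" for u v
  proof (rule reachable_map[where \<Gamma> = \<Gamma>])
    show "(u, v) \<in> (adj_rel \<Gamma>)\<^sup>*"
      using connected that by (simp add: connected_graph_def)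
    show "mpair \<Gamma> G x = mpair \<Gamma> G y \<or> {mpair \<Gamma> G x, mpair \<Gamma> G y} \<in> edges M"
      if "{x, y} \<in> edges \<Gamma>" for x y
      using that M_edgeI[of x y] mpair_partner[of x] simple_graph_edgeD(1)[OF simple that]
      by (auto simp: Rset_iff)
  qed
  then show ?thesis
    using connected by (auto simp: connected_graph_def verts_M)
qed

lemma regular_M: "regular_graph 4 M"
proof -
  have "card (nbhd M (mpair \<Gamma> G u)) = 4" if u: "u \<in> verts \<Gamma>" for u
  proof -
    \<comment> \<open>The R-arcs leaving the pair: two starting points with two R-neighbours each.
      Unique lifting makes their end pairs distinct.\<close>
    let ?S = "Sigma {u, p u} (nbhd Rgraph)"
    have mem: "mpair \<Gamma> G x = mpair \<Gamma> G u \<longleftrightarrow> x \<in> {u, p u}" if "x \<in> verts \<Gamma>" for x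
      using mpair_eq_iff[OF u that] by auto
    have S: "(x, y) \<in> ?S \<longleftrightarrow> mpair \<Gamma> G x = mpair \<Gamma> G u \<and> {x, y} \<in> Rset \<Gamma> G" for x y
      using mem[of x] Rset_edgeD(1)[of x y] by (auto simp: nbhd_def)
    have "nbhd M (mpair \<Gamma> G u) = (\<lambda>(x, y). mpair \<Gamma> G y) ` ?S"
    proof (intro subset_antisym subsetI)
      fix b assume "b \<in> nbhd M (mpair \<Gamma> G u)"
      then obtain x y where "{x, y} \<in> Rset \<Gamma> G" "mpair \<Gamma> G u = mpair \<Gamma> G x" "b = mpair \<Gamma> G y"
        unfolding nbhd_def by (blast elim: M_edgeE)
      then have "(x, y) \<in> ?S" "b = (\<lambda>(x, y). mpair \<Gamma> G y) (x, y)"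
        using S by simp_all
      then show "b \<in> (\<lambda>(x, y). mpair \<Gamma> G y) ` ?S"
        by blast
    next
      fix b assume "b \<in> (\<lambda>(x, y). mpair \<Gamma> G y) ` ?S"
      then obtain x y where "(x, y) \<in> ?S" "b = mpair \<Gamma> G y"
        by auto
      then show "b \<in> nbhd M (mpair \<Gamma> G u)"
        using S M_edgeI[of x y] by (simp add: nbhd_def)
    qed
    moreover have "inj_on (\<lambda>(x, y). mpair \<Gamma> G y) ?S"
    proof (rule inj_onI)
      fix s t assume s: "s \<in> ?S" and t: "t \<in> ?S"
        and eq: "(\<lambda>(x, y). mpair \<Gamma> G y) s = (\<lambda>(x, y). mpair \<Gamma> G y) t"
      obtain x y v w where st: "s = (x, y)" "t = (v, w)"
        by (metis prod.exhaust)
      then show "s = t"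
        using s t eq S[of x y] S[of v w] Rset_lift_unique[of x y v w] by simp
    qed
    moreover have "card ?S = 4"
    proof -
      have "card (nbhd Rgraph x) = 2" if "x \<in> {u, p u}" for x
        using that regular_Rgraph u partner_verts by (auto simp: regular_graph_def)
      moreover have "finite (nbhd Rgraph x)" for x
        using finite_verts Rset_edgeD(2)
        by (intro finite_subset[of "nbhd Rgraph x" "verts \<Gamma>"]) (auto simp: nbhd_def)
      ultimately show ?thesis
        using partner_neq[OF u] by (simp add: card_SigmaI)
    qed
    ultimately show ?thesis
      by (simp add: card_image)
  qed
  then show ?thesis
    by (auto simp: regular_graph_def verts_M)
qed

lemma card_verts_M: "2 * card (verts M) = card (verts \<Gamma>)"
proof -
  have union: "\<Union>(verts M) = verts \<Gamma>"
    using partner_verts by (auto simp: verts_M mpair_def)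
  have "card c = 2" if "c \<in> verts M" for c
    using that partner_neq by (auto simp: verts_M mpair_def card_2_iff)
  moreover have "c \<inter> d = {}" if "c \<in> verts M" "d \<in> verts M" "c \<noteq> d" for c d
    using that mem_TsetD(2) unfolding Mgraph_def by (auto dest: mem_TsetD(2))
  moreover have "finite (verts M)"
    using finite_verts by (simp add: verts_M)
  ultimately show ?thesis
    using card_partition[of "verts M" 2] finite_verts unfolding union by blast
qed

section \<open>The induced action of \<open>G\<close> on the quotient\<close>

lemma Maction_mpair:
  "g \<in> G \<Longrightarrow> u \<in> verts \<Gamma> \<Longrightarrow> Maction \<Gamma> G g (mpair \<Gamma> G u) = mpair \<Gamma> G (g u)"
  by (simp add: Maction_def Tset_eq image_mpair)

lemma Maction_verts: "g \<in> G \<Longrightarrow> a \<in> verts M \<Longrightarrow> Maction \<Gamma> G g a \<in> verts M"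
  using G_verts by (auto simp: verts_M Maction_mpair)

lemma Maction_inverse:
  assumes "g \<in> G" "h \<in> G" "\<And>x. x \<in> verts \<Gamma> \<Longrightarrow> h (g x) = x" "a \<in> verts M"
  shows "Maction \<Gamma> G h (Maction \<Gamma> G g a) = a"
  using assms G_verts[OF assms(1)] by (auto simp: verts_M Maction_mpair)

lemma Maction_edge:
  assumes "g \<in> G" "{a, b} \<in> edges M"
  shows "{Maction \<Gamma> G g a, Maction \<Gamma> G g b} \<in> edges M"
proof -
  obtain x y where xy: "{x, y} \<in> Rset \<Gamma> G" "a = mpair \<Gamma> G x" "b = mpair \<Gamma> G y"
    using M_edgeE[OF assms(2)] .
  then show ?thesis
    using M_edgeI[OF G_Rset[OF assms(1) xy(1)]] Rset_edgeD[OF xy(1)] assms(1)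
    by (simp add: Maction_mpair)
qed

lemma Maction_Bij: "g \<in> G \<Longrightarrow> Maction \<Gamma> G g \<in> Bij (verts M)"
proof -
  assume g: "g \<in> G"
  obtain h where h: "h \<in> G" "\<And>x. x \<in> verts \<Gamma> \<Longrightarrow> h (g x) = x" "\<And>x. x \<in> verts \<Gamma> \<Longrightarrow> g (h x) = x"
    using G_invE[OF g] by metis
  have "bij_betw (Maction \<Gamma> G g) (verts M) (verts M)"
    by (rule bij_betw_byWitness[where f' = "Maction \<Gamma> G h"])
      (use g h in \<open>auto simp: Maction_inverse Maction_verts\<close>)
  then show ?thesis
    by (simp add: Bij_def Maction_def Mgraph_def)
qed

lemma Maction_graph_auts:
  assumes g: "g \<in> G"
  shows "Maction \<Gamma> G g \<in> graph_auts M"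
proof -
  obtain h where h: "h \<in> G" "\<And>x. x \<in> verts \<Gamma> \<Longrightarrow> h (g x) = x" "\<And>x. x \<in> verts \<Gamma> \<Longrightarrow> g (h x) = x"
    using G_invE[OF g] by metis
  \<comment> \<open>Reflection of edges is preservation of edges under the inverse
    \<open>h\<close>.\<close>
  have "{a, b} \<in> edges M"
    if "a \<in> verts M" "b \<in> verts M" "{Maction \<Gamma> G g a, Maction \<Gamma> G g b} \<in> edges M" for a b
    using Maction_edge[OF h(1) that(3)] that(1,2) by (simp add: Maction_inverse g h(1,2))
  then show ?thesis
    using Maction_Bij[OF g] Maction_edge[OF g] by (auto simp: graph_auts_def)
qed

lemma group_action_M: "group_action (sub_aut \<Gamma> G) (verts M) (Maction \<Gamma> G)"
proof -
  have "Maction \<Gamma> G (g \<otimes>\<^bsub>aut_group \<Gamma>\<^esub> h) = compose (verts M) (Maction \<Gamma> G g) (Maction \<Gamma> G h)"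
    if gh: "g \<in> G" "h \<in> G" for g h
  proof (rule extensionalityI)
    show "Maction \<Gamma> G (g \<otimes>\<^bsub>aut_group \<Gamma>\<^esub> h) \<in> extensional (verts M)"
      by (simp add: Maction_def Mgraph_def)
    fix a assume "a \<in> verts M"
    then obtain u where u: "u \<in> verts \<Gamma>" "a = mpair \<Gamma> G u"
      by (auto simp: verts_M)
    then show "Maction \<Gamma> G (g \<otimes>\<^bsub>aut_group \<Gamma>\<^esub> h) a = compose (verts M) (Maction \<Gamma> G g) (Maction \<Gamma> G h) a"
      using gh subgroup.m_closed[OF subgroup_G gh] \<open>a \<in> verts M\<close>
      by (simp add: compose_eq Maction_mpair G_mult G_verts)
  qed simp
  then have "Maction \<Gamma> G \<in> hom (sub_aut \<Gamma> G) (BijGroup (verts M))"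
    by (auto simp: hom_def BijGroup_def Maction_Bij)
  moreover have "group (sub_aut \<Gamma> G)"
    using transitive by (simp add: transitive_action_def group_action_def group_hom_def)
  ultimately show ?thesis
    by (simp add: group_action_def group_hom_def group_hom_axioms_def group_BijGroup)
qed

text \<open>If \<open>g\<close> and \<open>h\<close> agree on pairs, the images under
  \<open>g\<close> and \<open>h\<close> of an R-edge at \<open>u\<close> lie over the same edge of
  \<open>M\<close>, so they coincide end by end and \<open>g u = h u\<close>. Extensionality turns
  agreement on vertices into equality.\<close>

lemma faithful_M: "faithful_action (sub_aut \<Gamma> G) (verts M) (Maction \<Gamma> G)"
proof -
  have "inj_on (Maction \<Gamma> G) G"
  proof (rule inj_onI)
    fix g h assume g: "g \<in> G" and h: "h \<in> G" and eq: "Maction \<Gamma> G g = Maction \<Gamma> G h"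
    have "g u = h u" if u: "u \<in> verts \<Gamma>" for u
    proof -
      obtain y where y: "{u, y} \<in> Rset \<Gamma> G"
        using Rset_other_neighbour[OF u] .
      have "mpair \<Gamma> G (g x) = mpair \<Gamma> G (h x)" if "x \<in> verts \<Gamma>" for x
        using eq that Maction_mpair[OF g that] Maction_mpair[OF h that] by simp
      then show ?thesis
        using Rset_lift_unique[OF G_Rset[OF g y] G_Rset[OF h y]] u Rset_edgeD(2)[OF y] by blast
    qed
    moreover have "g \<in> extensional (verts \<Gamma>)" "h \<in> extensional (verts \<Gamma>)"
      using G_subset g h by (auto simp: graph_auts_def Bij_def)
    ultimately show "g = h"
      by (metis extensionalityI)
  qed
  then show ?thesis
    using group_action_M by (simp add: faithful_action_def faithful_action_axioms_def)
qed

lemma arc_transitive_M: "arc_transitive (sub_aut \<Gamma> G) M (Maction \<Gamma> G)"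
proof -
  have "\<exists>g\<in>G. Maction \<Gamma> G g a = c \<and> Maction \<Gamma> G g b = d"
    if ab: "{a, b} \<in> edges M" and cd: "{c, d} \<in> edges M" for a b c d
  proof -
    obtain x y where xy: "{x, y} \<in> Rset \<Gamma> G" "a = mpair \<Gamma> G x" "b = mpair \<Gamma> G y"
      using M_edgeE[OF ab] .
    obtain u v where uv: "{u, v} \<in> Rset \<Gamma> G" "c = mpair \<Gamma> G u" "d = mpair \<Gamma> G v"
      using M_edgeE[OF cd] .
    obtain g where "g \<in> G" "g x = u" "g y = v"
      using Rset_arc_transitive[OF xy(1) uv(1)] .
    then show ?thesis
      using xy uv Rset_edgeD[OF xy(1)] Maction_mpair by blast
  qed
  then show ?thesis
    using group_action_M Maction_graph_auts by (simp add: arc_transitive_def acts_on_graph_def)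
qed

section \<open>The cycle decomposition and its invariance\<close>

lemma components_Rgraph_edges: "C \<in> components Rgraph \<Longrightarrow> edges C \<subseteq> Rset \<Gamma> G"
  using edges_component_of_subset[of Rgraph] by (auto simp: components_eq)

text \<open>Since \<open>iota \<Gamma> G\<close> is injective on all of R, different components keep
  disjoint images; this gives uniqueness in the decomposition.\<close>

lemma iota_mem_iff:
  assumes "C \<in> components Rgraph" "f \<in> Rset \<Gamma> G"
  shows "iota \<Gamma> G f \<in> iota \<Gamma> G ` edges C \<longleftrightarrow> f \<in> edges C"
  using inj_on_image_mem_iff[OF inj_on_iota assms(2) components_Rgraph_edges[OF assms(1)]] .

lemma cycle_decomposition_M: "cycle_decomposition M (Ccycles \<Gamma> G)"
  unfolding cycle_decomposition_def
proof (intro conjI ballI)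
  fix D assume "D \<in> Ccycles \<Gamma> G"
  then obtain v where v: "v \<in> verts \<Gamma>" and D: "D = iota \<Gamma> G ` edges (component_of Rgraph v)"
    by (auto simp: Ccycles_def components_eq)
  let ?C = "component_of Rgraph v"
  let ?S = "image_graph (mpair \<Gamma> G) ?C"
  have C: "simple_graph ?C"
    using subgraph_component_of[OF simple_Rgraph] by (simp add: subgraph_of_def)
  have edges_S: "edges ?S = D"
    by (simp add: D iota_def image_def)
  have "D \<subseteq> edges M"
    using edges_component_of_subset[of Rgraph v] by (auto simp: D edges_M)
  then have "subgraph_of ?S M"
    unfolding subgraph_of_def edges_S
    using simple_image_graph[OF C inj_on_mpair_component] by (auto simp: verts_M verts_component_of)
  moreover have "connected_graph ?S"
    using connected_component_of[OF simple_Rgraph] v by (simp add: connected_image_graph)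
  moreover have "regular_graph 2 ?S"
    using regular_image_graph[OF C inj_on_mpair_component]
      regular_component_of[OF simple_Rgraph regular_Rgraph] .
  ultimately show "\<exists>S. is_cycle_in M S \<and> edges S = D"
    using edges_S unfolding is_cycle_in_def by blast
next
  fix e assume "e \<in> edges M"
  then obtain f where f: "f \<in> Rset \<Gamma> G" and e: "e = iota \<Gamma> G f"
    by (auto simp: edges_M)
  obtain C where C: "C \<in> components Rgraph" "f \<in> edges C"
    and unique: "\<And>C'. C' \<in> components Rgraph \<Longrightarrow> f \<in> edges C' \<Longrightarrow> C' = C"
    using ex1_component_edge[OF simple_Rgraph, of f] f by auto
  show "\<exists>!D. D \<in> Ccycles \<Gamma> G \<and> e \<in> D"
  proof (rule ex1I[of _ "iota \<Gamma> G ` edges C"])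
    show "iota \<Gamma> G ` edges C \<in> Ccycles \<Gamma> G \<and> e \<in> iota \<Gamma> G ` edges C"
      using C e by (auto simp: Ccycles_def)
    fix D assume D: "D \<in> Ccycles \<Gamma> G \<and> e \<in> D"
    then obtain C' where C': "C' \<in> components Rgraph" "D = iota \<Gamma> G ` edges C'"
      by (auto simp: Ccycles_def)
    then have "f \<in> edges C'"
      using D e iota_mem_iff[OF C'(1) f] by simp
    then show "D = iota \<Gamma> G ` edges C"
      using unique C' by blast
  qed
qed

text \<open>The map \<open>iota \<Gamma> G\<close> intertwines the actions of \<open>G\<close> on
  R-edges and on edges of \<open>M\<close>, and \<open>g\<close> takes the component of
  \<open>v\<close> in R to that of \<open>g v\<close>.\<close>

lemma preserves_cycles_M: "preserves_cycles (sub_aut \<Gamma> G) (Maction \<Gamma> G) (Ccycles \<Gamma> G)"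
proof -
  have "(\<lambda>e. Maction \<Gamma> G g ` e) ` D \<in> Ccycles \<Gamma> G" if g: "g \<in> G" and "D \<in> Ccycles \<Gamma> G" for g D
  proof -
    obtain v where v: "v \<in> verts \<Gamma>" and D: "D = iota \<Gamma> G ` edges (component_of Rgraph v)"
      using \<open>D \<in> Ccycles \<Gamma> G\<close> by (auto simp: Ccycles_def components_eq)
    obtain h where h: "h \<in> G" "\<And>x. x \<in> verts \<Gamma> \<Longrightarrow> h (g x) = x" "\<And>x. x \<in> verts \<Gamma> \<Longrightarrow> g (h x) = x"
      using G_invE[OF g] by metis
    have "Maction \<Gamma> G g ` iota \<Gamma> G f = iota \<Gamma> G (g ` f)" if "f \<in> edges (component_of Rgraph v)" for f
    proof -
      have "f \<in> Rset \<Gamma> G"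
        using that edges_component_of_subset[of Rgraph v] by auto
      then have "f \<subseteq> verts \<Gamma>"
        using simple by (auto simp: simple_graph_def Rset_def)
      then show ?thesis
        using Maction_mpair[OF g] by (force simp: iota_def image_image)
    qed
    then have "(\<lambda>e. Maction \<Gamma> G g ` e) ` D = iota \<Gamma> G ` ((`) g ` edges (component_of Rgraph v))"
      by (simp add: D image_image)
    also have "(`) g ` edges (component_of Rgraph v) = edges (component_of Rgraph (g v))"
      by (rule edges_component_of_image[OF simple_Rgraph, where h = h])
        (use g h v G_Rset in simp_all)
    finally show ?thesis
      using G_verts[OF g v] by (auto simp: Ccycles_def components_eq)
  qed
  then show ?thesis
    by (simp add: preserves_cycles_def)
qed

end

theorem theorem4p6:
  fixes \<Gamma> :: "'a ugraph" and G :: "('a \<Rightarrow> 'a) set"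
  assumes "simple_graph \<Gamma>"
    and "finite (verts \<Gamma>)"
    and "connected_graph \<Gamma>"
    and "regular_graph 3 \<Gamma>"
    and "subgroup G (aut_group \<Gamma>)"
    and "transitive_action (sub_aut \<Gamma> G) (verts \<Gamma>) (\<lambda>g. g)"
    and "locally_Z2_3 \<Gamma> G"
    and "\<not> degenerate \<Gamma> G"
  shows "simple_graph (Mgraph \<Gamma> G)
    \<and> connected_graph (Mgraph \<Gamma> G)
    \<and> regular_graph 4 (Mgraph \<Gamma> G)
    \<and> arc_transitive (sub_aut \<Gamma> G) (Mgraph \<Gamma> G) (Maction \<Gamma> G)
    \<and> faithful_action (sub_aut \<Gamma> G) (verts (Mgraph \<Gamma> G)) (Maction \<Gamma> G)
    \<and> 2 * card (verts (Mgraph \<Gamma> G)) = card (verts \<Gamma>)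
    \<and> cycle_decomposition (Mgraph \<Gamma> G) (Ccycles \<Gamma> G)
    \<and> preserves_cycles (sub_aut \<Gamma> G) (Maction \<Gamma> G) (Ccycles \<Gamma> G)
    \<and> arc_transitive_cycle_decomposition (sub_aut \<Gamma> G) (Mgraph \<Gamma> G) (Maction \<Gamma> G)
           (Ccycles \<Gamma> G)"
proof -
  interpret nondegenerate_Z2 \<Gamma> G
    by (intro nondegenerate_Z2.intro vertex_transitive_Z2.intro nondegenerate_Z2_axioms.intro)
      (rule assms)+
  show ?thesis
    using simple_M connected_M regular_M arc_transitive_M faithful_M card_verts_M
      cycle_decomposition_M preserves_cycles_M
    by (simp add: arc_transitive_cycle_decomposition_def)
qed

end
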